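(* Let $n\ge2$ and $m,l\ge2$ be integers, and let $\bar\Xi:=(\bar\Lambda,\bar{\boldsymbol a},\bar\Theta,\bar{\boldsymbol b},\bar K)\in\mathcal F_{m,n}\times\mathbb R^n\times\mathcal F_{l,n}\times\mathbb R^n\times\mathscr C(\mathbb R^n)$. If the leading tensor pair $(\bar{\mathcal A}^{(1)},\bar{\mathcal B}^{(1)})$ in $(\bar\Lambda,\bar\Theta)$ is an $\mathbf R_0^{\bar K}$-tensor pair, then the mapping $\mathrm{SOL}(\cdot)$ is upper semicontinuous at $\bar\Xi$.
   Context: $\mathbb T_{m,n}$ is the space of real $m$-th order $n$-dimensional square tensors $\mathcal A=(a_{j_1\ldots j_m})$, $1\le j_1,\ldots,j_m\le n$, with Frobenius norm $\|\mathcal A\|_F=(\sum a_{j_1\ldots j_m}^2)^{1/2}$. $\mathcal F_{m,n}:=\mathbb T_{m,n}\times\mathbb T_{m-1,n}\times\cdots\times\mathbb T_{2,n}$, with elements written $\Lambda=(\mathcal A^{(1)},\ldots,\mathcal A^{(m-1)})$, $\mathcal A^{(k)}\in\mathbb T_{m-k+1,n}$, and distance $\|\Lambda_1-\Lambda_2\|_F=\big(\sum_{k=1}^{m-1}\|\mathcal A_1^{(k)}-\mathcal A_2^{(k)}\|_F^2\big)^{1/2}$; elements of $\mathcal F_{l,n}$ are written $\Theta=(\mathcal B^{(1)},\ldots,\mathcal B^{(l-1)})$. The leading tensor pair of $(\Lambda,\Theta)$ is $(\mathcal A^{(1)},\mathcal B^{(1)})$. For $\mathcal A\in\mathbb T_{m,n}$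 and $\boldsymbol x\in\mathbb R^n$, $\mathcal A\boldsymbol x^{m-1}\in\mathbb R^n$ has $j$-th component $\sum_{j_2,\ldots,j_m=1}^n a_{jj_2\ldots j_m}x_{j_2}\cdots x_{j_m}$. $\mathscr C(\mathbb R^n)$ is the set of nonzero closed convex cones in $\mathbb R^n$, with metric $\delta(K_1,K_2):=\sup_{\|\boldsymbol z\|\le1}|\mathrm{dist}(\boldsymbol z,K_1)-\mathrm{dist}(\boldsymbol z,K_2)|$, where $\mathrm{dist}(\boldsymbol z,K)=\inf_{\boldsymbol u\in K}\|\boldsymbol z-\boldsymbol u\|$. Products carry the product topology. The dual cone of $K$ is $K^*:=\{\boldsymbol y\in\mathbb R^n\mid\langle\boldsymbol y,\boldsymbol x\rangle\ge0\ \forall\boldsymbol x\in K\}$. $\mathrm{SOL}(\Lambda,\boldsymbol a,\Theta,\boldsymbol b,K)$ is the set of all $\boldsymbol x\in\mathbb R^n$ with $F(\boldsymbol x)\in K$, $G(\boldsymbol x)\in K^*$, $\langle F(\boldsymbol x),G(\boldsymbol x)\rangle=0$, where $F(\boldsymbol x):=\sum_{k=1}^{m-1}\mathcal A^{(k)}\boldsymbol x^{m-k}+\boldsymbol a$ and $G(\boldsymbol x):=\sum_{p=1}^{l-1}\mathcal B^{(p)}\boldsymbol x^{l-p}+\boldsymbol b$. $\mathrm{SOL}(\cdot)$ is regarded as a set-valued mapping from $\mathcal F_{m,n}\times\mathbb R^n\times\mathcal F_{l,n}\times\mathbb R^n\times\mathscr C(\mathbb R^n)$ to subsets of $\mathbb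 R^n$. For topological spaces $W,Y$, a mapping $\Psi:W\to2^Y$ is upper semicontinuous at $\bar w\in W$ if for every open set $U$ with $\Psi(\bar w)\subset U$ there exists an open neighborhood $V$ of $\bar w$ such that $\Psi(w)\subset U$ for each $w\in V$. A pair $(\mathcal A,\mathcal B)\in\mathbb T_{m,n}\times\mathbb T_{l,n}$ is an $\mathbf R_0^K$-tensor pair if there exists no $\boldsymbol x\in\mathbb R^n\setminus\{\boldsymbol 0\}$ such that $\mathcal A\boldsymbol x^{m-1}\in K$, $\mathcal B\boldsymbol x^{l-1}\in K^*$ and $\langle\mathcal A\boldsymbol x^{m-1},\mathcal B\boldsymbol x^{l-1}\rangle=0$. *)

theory Defs
  imports "HOL-Analysis.Analysis"
begin

section \<open>Tensors\<close>

text \<open>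
  The index set \<open>{1, \<dots>, n}\<close> is a finite type \<open>'n\<close> with \<open>CARD('n) = n\<close>. An entry
  \<open>a\<close> with indices \<open>j\<^sub>1, \<dots>, j\<^sub>p\<close> of an order-\<open>p\<close> tensor \<open>A\<close> is \<open>A [j\<^sub>1, \<dots>, j\<^sub>p]\<close>.
  As the order is not part of the type, a tensor is required to vanish on lists of any
  other length, so that equality of functions is equality of entries.
\<close>

type_synonym 'n tensor = "'n list \<Rightarrow> real"

definition multi_indices :: "nat \<Rightarrow> 'n list set" where
  "multi_indices p = {js. length js = p}"

definition tensors :: "nat \<Rightarrow> 'n tensor set" where
  "tensors p = {A. \<forall>js. js \<notin> multi_indices p \<longrightarrow> A js = 0}"

definition frobenius_norm :: "nat \<Rightarrow> 'n tensor \<Rightarrow> real" where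
  "frobenius_norm p A = L2_set A (multi_indices p)"

text \<open>For \<open>A\<close> of order \<open>p\<close>, this is the vector \<open>A x\<^sup>p\<^sup>-\<^sup>1\<close>.\<close>

definition tensor_apply :: "nat \<Rightarrow> 'n::finite tensor \<Rightarrow> real ^ 'n \<Rightarrow> real ^ 'n" where
  "tensor_apply p A x =
     (\<chi> j. \<Sum>js\<in>multi_indices (p - 1). A (j # js) * (\<Prod>i\<leftarrow>js. x $ i))"

text \<open>Component \<open>k\<close> of a tuple in \<open>tensor_tuples m\<close> has order \<open>m - k + 1\<close>, for \<open>k = 1, \<dots>, m - 1\<close>.\<close>

type_synonym 'n tensor_tuple = "nat \<Rightarrow> 'n tensor"

definition tensor_tuples :: "nat \<Rightarrow> 'n tensor_tuple set" where
  "tensor_tuples m = (\<Pi>\<^sub>E k\<in>{1..m - 1}. tensors (m - k + 1))"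

definition tuple_dist :: "nat \<Rightarrow> 'n tensor_tuple \<Rightarrow> 'n tensor_tuple \<Rightarrow> real" where
  "tuple_dist m \<Lambda>\<^sub>1 \<Lambda>\<^sub>2 =
     L2_set (\<lambda>k. frobenius_norm (m - k + 1) (\<lambda>js. \<Lambda>\<^sub>1 k js - \<Lambda>\<^sub>2 k js)) {1..m - 1}"

definition tuple_poly ::
  "nat \<Rightarrow> 'n::finite tensor_tuple \<Rightarrow> real ^ 'n \<Rightarrow> real ^ 'n \<Rightarrow> real ^ 'n" where
  "tuple_poly m \<Lambda> a x = (\<Sum>k = 1..m - 1. tensor_apply (m - k + 1) (\<Lambda> k) x) + a"


section \<open>Cones\<close>

text \<open>\<open>convex_cone\<close> includes nonemptiness; \<open>dist(z, K)\<close> is \<open>infdist z K\<close>.\<close>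

definition closed_convex_cones :: "(real ^ 'n::finite) set set" where
  "closed_convex_cones = {K. closed K \<and> convex_cone K \<and> K \<noteq> {0}}"

definition cone_dist :: "(real ^ 'n::finite) set \<Rightarrow> (real ^ 'n) set \<Rightarrow> real" where
  "cone_dist K\<^sub>1 K\<^sub>2 = (SUP z\<in>{z. norm z \<le> 1}. \<bar>infdist z K\<^sub>1 - infdist z K\<^sub>2\<bar>)"

definition dual_cone :: "(real ^ 'n::finite) set \<Rightarrow> (real ^ 'n) set" where
  "dual_cone K = {y. \<forall>x\<in>K. y \<bullet> x \<ge> 0}"


section \<open>The solution mapping\<close>

type_synonym 'n problem =
  "'n tensor_tuple \<times> (real ^ 'n) \<times> 'n tensor_tuple \<times> (real ^ 'n) \<times> (real ^ 'n) set"

definition SOL :: "nat \<Rightarrow> nat \<Rightarrow> 'n::finite problem \<Rightarrow> (real ^ 'n) set" where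
  "SOL m l = (\<lambda>(\<Lambda>, a, \<Theta>, b, K).
     {x. tuple_poly m \<Lambda> a x \<in> K \<and> tuple_poly l \<Theta> b x \<in> dual_cone K \<and>
         tuple_poly m \<Lambda> a x \<bullet> tuple_poly l \<Theta> b x = 0})"

definition problem_topology :: "nat \<Rightarrow> nat \<Rightarrow> 'n::finite problem topology" where
  "problem_topology m l =
     prod_topology (Metric_space.mtopology (tensor_tuples m) (tuple_dist m))
       (prod_topology euclidean
         (prod_topology (Metric_space.mtopology (tensor_tuples l) (tuple_dist l))
           (prod_topology euclidean
             (Metric_space.mtopology closed_convex_cones cone_dist))))"

definition upper_semicontinuous_at ::
  "'w topology \<Rightarrow> 'y topology \<Rightarrow> ('w \<Rightarrow> 'y set) \<Rightarrow> 'w \<Rightarrow> bool" where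
  "upper_semicontinuous_at W Y \<Psi> w\<^sub>0 \<longleftrightarrow>
     (\<forall>U. openin Y U \<and> \<Psi> w\<^sub>0 \<subseteq> U \<longrightarrow> (\<exists>V. openin W V \<and> w\<^sub>0 \<in> V \<and> (\<forall>w\<in>V. \<Psi> w \<subseteq> U)))"

definition R0_tensor_pair ::
  "nat \<Rightarrow> nat \<Rightarrow> (real ^ 'n::finite) set \<Rightarrow> 'n tensor \<Rightarrow> 'n tensor \<Rightarrow> bool" where
  "R0_tensor_pair m l K A B \<longleftrightarrow>
     \<not> (\<exists>x. x \<noteq> 0 \<and> tensor_apply m A x \<in> K \<and> tensor_apply l B x \<in> dual_cone K \<and>
            tensor_apply m A x \<bullet> tensor_apply l B x = 0)"


section \<open>The metric spaces\<close>

text \<open>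
  \<^const>\<open>Metric_space.mtopology\<close> is only meaningful for an actual metric, which the
  following lemmas establish for both spaces used in \<open>problem_topology\<close>.
\<close>

lemma finite_multi_indices [simp]: "finite (multi_indices p :: 'n::finite list set)"
  unfolding multi_indices_def using finite_lists_length_eq[of "UNIV :: 'n set" p] by simp

lemma frobenius_norm_triangle:
  "frobenius_norm p (\<lambda>js. A js + B js) \<le> frobenius_norm p A + frobenius_norm p B"
  unfolding frobenius_norm_def by (rule L2_set_triangle_ineq)

lemma Metric_space_tensor_tuples:
  "Metric_space (tensor_tuples m :: 'n::finite tensor_tuple set) (tuple_dist m)"
proof
  fix \<Lambda>\<^sub>1 \<Lambda>\<^sub>2 :: "'n tensor_tuple"
  show "0 \<le> tuple_dist m \<Lambda>\<^sub>1 \<Lambda>\<^sub>2"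
    by (simp add: tuple_dist_def)
  show "tuple_dist m \<Lambda>\<^sub>1 \<Lambda>\<^sub>2 = tuple_dist m \<Lambda>\<^sub>2 \<Lambda>\<^sub>1"
    by (simp add: tuple_dist_def frobenius_norm_def L2_set_def power2_commute)
next
  fix \<Lambda>\<^sub>1 \<Lambda>\<^sub>2 :: "'n tensor_tuple"
  assume mem: "\<Lambda>\<^sub>1 \<in> tensor_tuples m" "\<Lambda>\<^sub>2 \<in> tensor_tuples m"
  show "tuple_dist m \<Lambda>\<^sub>1 \<Lambda>\<^sub>2 = 0 \<longleftrightarrow> \<Lambda>\<^sub>1 = \<Lambda>\<^sub>2"
  proof
    assume "tuple_dist m \<Lambda>\<^sub>1 \<Lambda>\<^sub>2 = 0"
    then have eq: "\<Lambda>\<^sub>1 k js = \<Lambda>\<^sub>2 k js"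
      if "k \<in> {1..m - 1}" "js \<in> multi_indices (m - k + 1)" for k js
      using that by (auto simp: tuple_dist_def frobenius_norm_def L2_set_eq_0_iff)
    show "\<Lambda>\<^sub>1 = \<Lambda>\<^sub>2"
    proof (rule PiE_ext)
      show "\<Lambda>\<^sub>1 \<in> (\<Pi>\<^sub>E k\<in>{1..m - 1}. tensors (m - k + 1))"
        "\<Lambda>\<^sub>2 \<in> (\<Pi>\<^sub>E k\<in>{1..m - 1}. tensors (m - k + 1))"
        using mem by (simp_all add: tensor_tuples_def)
    next
      fix k assume k: "k \<in> {1..m - 1}"
      have "\<Lambda>\<^sub>1 k \<in> tensors (m - k + 1)" "\<Lambda>\<^sub>2 k \<in> tensors (m - k + 1)"
        using mem k unfolding tensor_tuples_def by (blast intro: PiE_mem)+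
      then have "\<Lambda>\<^sub>1 k js = \<Lambda>\<^sub>2 k js" for js
        using eq[OF k, of js] by (cases "js \<in> multi_indices (m - k + 1)") (auto simp: tensors_def)
      then show "\<Lambda>\<^sub>1 k = \<Lambda>\<^sub>2 k" ..
    qed
  qed (simp add: tuple_dist_def frobenius_norm_def L2_set_eq_0_iff)
next
  fix \<Lambda>\<^sub>1 \<Lambda>\<^sub>2 \<Lambda>\<^sub>3 :: "'n tensor_tuple"
  have "frobenius_norm (m - k + 1) (\<lambda>js. \<Lambda>\<^sub>1 k js - \<Lambda>\<^sub>3 k js) \<le>
      frobenius_norm (m - k + 1) (\<lambda>js. \<Lambda>\<^sub>1 k js - \<Lambda>\<^sub>2 k js) +
      frobenius_norm (m - k + 1) (\<lambda>js. \<Lambda>\<^sub>2 k js - \<Lambda>\<^sub>3 k js)" for k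
    using frobenius_norm_triangle[of "m - k + 1" "\<lambda>js. \<Lambda>\<^sub>1 k js - \<Lambda>\<^sub>2 k js" "\<lambda>js. \<Lambda>\<^sub>2 k js - \<Lambda>\<^sub>3 k js"]
    by simp
  then have "tuple_dist m \<Lambda>\<^sub>1 \<Lambda>\<^sub>3 \<le> L2_set (\<lambda>k.
      frobenius_norm (m - k + 1) (\<lambda>js. \<Lambda>\<^sub>1 k js - \<Lambda>\<^sub>2 k js) +
      frobenius_norm (m - k + 1) (\<lambda>js. \<Lambda>\<^sub>2 k js - \<Lambda>\<^sub>3 k js)) {1..m - 1}"
    unfolding tuple_dist_def by (intro L2_set_mono) (auto simp: frobenius_norm_def)
  also have "\<dots> \<le> tuple_dist m \<Lambda>\<^sub>1 \<Lambda>\<^sub>2 + tuple_dist m \<Lambda>\<^sub>2 \<Lambda>\<^sub>3"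
    unfolding tuple_dist_def by (rule L2_set_triangle_ineq)
  finally show "tuple_dist m \<Lambda>\<^sub>1 \<Lambda>\<^sub>3 \<le> tuple_dist m \<Lambda>\<^sub>1 \<Lambda>\<^sub>2 + tuple_dist m \<Lambda>\<^sub>2 \<Lambda>\<^sub>3" .
qed

lemma bdd_above_cone_dist:
  fixes K\<^sub>1 K\<^sub>2 :: "(real ^ 'n::finite) set"
  shows "bdd_above ((\<lambda>z. \<bar>infdist z K\<^sub>1 - infdist z K\<^sub>2\<bar>) ` {z. norm z \<le> 1})"
proof (rule bdd_aboveI2)
  fix z :: "real ^ 'n"
  assume "z \<in> {z. norm z \<le> 1}"
  then have "infdist z K \<le> infdist 0 K + 1" for K
    using infdist_triangle[of z K 0] by simp
  from this[of K\<^sub>1] this[of K\<^sub>2]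
  show "\<bar>infdist z K\<^sub>1 - infdist z K\<^sub>2\<bar> \<le> infdist 0 K\<^sub>1 + infdist 0 K\<^sub>2 + 1"
    using infdist_nonneg[of z K\<^sub>1] infdist_nonneg[of z K\<^sub>2]
      infdist_nonneg[of 0 K\<^sub>1] infdist_nonneg[of 0 K\<^sub>2] by linarith
qed

lemma infdist_diff_le_cone_dist:
  "norm z \<le> 1 \<Longrightarrow> \<bar>infdist z K\<^sub>1 - infdist z K\<^sub>2\<bar> \<le> cone_dist K\<^sub>1 K\<^sub>2"
  unfolding cone_dist_def by (rule cSUP_upper[OF _ bdd_above_cone_dist]) simp

lemma cone_dist_least:
  assumes "\<And>z. norm z \<le> 1 \<Longrightarrow> \<bar>infdist z K\<^sub>1 - infdist z K\<^sub>2\<bar> \<le> c"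
  shows "cone_dist K\<^sub>1 K\<^sub>2 \<le> c"
proof -
  have "(0 :: real ^ 'a) \<in> {z. norm z \<le> 1}" by simp
  then have "{z :: real ^ 'a. norm z \<le> 1} \<noteq> {}" by blast
  then show ?thesis unfolding cone_dist_def by (rule cSUP_least) (simp add: assms)
qed

lemma subset_if_cone_dist_zero:
  assumes "cone_dist K\<^sub>1 K\<^sub>2 = 0"
    and K: "K\<^sub>1 \<in> closed_convex_cones" "K\<^sub>2 \<in> closed_convex_cones"
  shows "K\<^sub>1 \<subseteq> K\<^sub>2"
proof
  fix x assume x: "x \<in> K\<^sub>1"
  define c where "c = inverse (norm x + 1)"
  have c: "c > 0" unfolding c_def using norm_ge_zero[of x] by (simp add: add_nonneg_pos)
  have "norm (c *\<^sub>R x) \<le> 1"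
    using norm_ge_zero[of x] by (auto simp: c_def divide_simps not_less)
  then have "infdist (c *\<^sub>R x) K\<^sub>1 = infdist (c *\<^sub>R x) K\<^sub>2"
    using infdist_diff_le_cone_dist[of "c *\<^sub>R x" K\<^sub>1 K\<^sub>2] assms(1) by simp
  moreover have "c *\<^sub>R x \<in> K\<^sub>1"
    using K(1) x c by (auto simp: closed_convex_cones_def intro: convex_cone_scaleR)
  ultimately have "infdist (c *\<^sub>R x) K\<^sub>2 = 0" by simp
  then have "c *\<^sub>R x \<in> K\<^sub>2"
    using K(2) by (simp add: in_closed_iff_infdist_zero closed_convex_cones_def convex_cone_nonempty)
  moreover have "convex_cone K\<^sub>2"
    using K(2) by (simp add: closed_convex_cones_def)
  ultimately have "inverse c *\<^sub>R (c *\<^sub>R x) \<in> K\<^sub>2"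
    using c convex_cone_scaleR[of K\<^sub>2 "inverse c" "c *\<^sub>R x"] by simp
  then show "x \<in> K\<^sub>2" using c by simp
qed

lemma Metric_space_closed_convex_cones:
  "Metric_space (closed_convex_cones :: (real ^ 'n::finite) set set) cone_dist"
proof
  fix K\<^sub>1 K\<^sub>2 :: "(real ^ 'n) set"
  show "0 \<le> cone_dist K\<^sub>1 K\<^sub>2"
    using infdist_diff_le_cone_dist[of 0 K\<^sub>1 K\<^sub>2] by simp
  show comm: "cone_dist K\<^sub>1 K\<^sub>2 = cone_dist K\<^sub>2 K\<^sub>1"
    by (simp add: cone_dist_def abs_minus_commute)
  assume K: "K\<^sub>1 \<in> closed_convex_cones" "K\<^sub>2 \<in> closed_convex_cones"
  show "cone_dist K\<^sub>1 K\<^sub>2 = 0 \<longleftrightarrow> K\<^sub>1 = K\<^sub>2"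
  proof
    assume "cone_dist K\<^sub>1 K\<^sub>2 = 0"
    then show "K\<^sub>1 = K\<^sub>2"
      using subset_if_cone_dist_zero[of K\<^sub>1 K\<^sub>2] subset_if_cone_dist_zero[of K\<^sub>2 K\<^sub>1] K comm by auto
  next
    assume "K\<^sub>1 = K\<^sub>2"
    then show "cone_dist K\<^sub>1 K\<^sub>2 = 0"
      using cone_dist_least[of K\<^sub>1 K\<^sub>2 0] infdist_diff_le_cone_dist[of 0 K\<^sub>1 K\<^sub>2] by simp
  qed
next
  fix K\<^sub>1 K\<^sub>2 K\<^sub>3 :: "(real ^ 'n) set"
  show "cone_dist K\<^sub>1 K\<^sub>3 \<le> cone_dist K\<^sub>1 K\<^sub>2 + cone_dist K\<^sub>2 K\<^sub>3"
  proof (rule cone_dist_least)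
    fix z :: "real ^ 'n" assume "norm z \<le> 1"
    then show "\<bar>infdist z K\<^sub>1 - infdist z K\<^sub>3\<bar> \<le> cone_dist K\<^sub>1 K\<^sub>2 + cone_dist K\<^sub>2 K\<^sub>3"
      using infdist_diff_le_cone_dist[of z K\<^sub>1 K\<^sub>2] infdist_diff_le_cone_dist[of z K\<^sub>2 K\<^sub>3] by linarith
  qed
qed

lemma topspace_problem_topology:
  "topspace (problem_topology m l :: 'n::finite problem topology) =
     tensor_tuples m \<times> UNIV \<times> tensor_tuples l \<times> UNIV \<times> closed_convex_cones"
  by (simp add: problem_topology_def Metric_space.topspace_mtopology
      Metric_space_tensor_tuples Metric_space_closed_convex_cones)

end

theory Submission
  imports Defs
begin

text \<open>
  Homogenise: with \<open>t = 1 / max 1 \<parallel>x\<parallel>\<close> and \<open>y = t x\<close>, the vector \<open>t\<^sup>m\<^sup>-\<^sup>1 F(x)\<close> is a polynomial in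
  \<open>(t, y)\<close> that reduces to the leading term at \<open>t = 0\<close>. The pairs \<open>(t, y)\<close> stay in a compact
  set, so solutions of problems converging to the given one have a cluster point \<open>(t, y)\<close>, which
  solves the homogenised limit problem since cones and dual cones vary continuously. If
  \<open>t > 0\<close>, then \<open>y / t\<close> is a cluster point of the solutions themselves and solves the limit
  problem. If \<open>t = 0\<close>, then \<open>\<parallel>y\<parallel> = 1\<close> and \<open>y\<close> contradicts the \<open>R\<^sub>0\<close> property.
\<close>

section \<open>Homogenisation\<close>

text \<open>The weight \<open>t ^ (k - 1)\<close> complements the degree \<open>m - k\<close> of the
  k-th term in \<open>y\<close>, so the whole is homogeneous of degree \<open>m - 1\<close> in
  \<open>(t, y)\<close>. Setting \<open>t = 1\<close> recovers \<open>tuple_poly\<close>, and no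
  division by \<open>t\<close> occurs, so \<open>t = 0\<close> is allowed.\<close>

definition homogenized_poly ::
  "nat \<Rightarrow> 'n::finite tensor_tuple \<Rightarrow> real ^ 'n \<Rightarrow> real \<Rightarrow> real ^ 'n \<Rightarrow> real ^ 'n" where
  "homogenized_poly m \<Lambda> a t y =
     (\<Sum>k = 1..m - 1. t ^ (k - 1) *\<^sub>R tensor_apply (m - k + 1) (\<Lambda> k) y) + t ^ (m - 1) *\<^sub>R a"

lemma prod_list_scaleR:
  fixes x :: "real ^ 'n"
  shows "(\<Prod>i\<leftarrow>js. (t *\<^sub>R x) $ i) = t ^ length js * (\<Prod>i\<leftarrow>js. x $ i)"
  by (induction js) auto

lemma tensor_apply_scaleR:
  "tensor_apply p A (t *\<^sub>R x) = t ^ (p - 1) *\<^sub>R tensor_apply p A x"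
proof -
  have "tensor_apply p A (t *\<^sub>R x) $ j = t ^ (p - 1) * tensor_apply p A x $ j" for j
    unfolding tensor_apply_def vec_lambda_beta sum_distrib_left prod_list_scaleR
    by (intro sum.cong) (auto simp: multi_indices_def)
  then show ?thesis by (simp add: vec_eq_iff)
qed

lemma homogenized_poly_scaleR:
  "homogenized_poly m \<Lambda> a t (t *\<^sub>R x) = t ^ (m - 1) *\<^sub>R tuple_poly m \<Lambda> a x"
proof -
  have "t ^ (k - 1) *\<^sub>R tensor_apply (m - k + 1) (\<Lambda> k) (t *\<^sub>R x) =
      t ^ (m - 1) *\<^sub>R tensor_apply (m - k + 1) (\<Lambda> k) x" if "k \<in> {1..m - 1}" for k
  proof -
    \<comment> \<open>The range of \<open>k\<close> makes the truncated subtractions exact.\<close>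
    have "k - 1 + (m - k) = m - 1" using that by auto
    then have "t ^ (k - 1) * t ^ (m - k) = t ^ (m - 1)" by (metis power_add)
    then show ?thesis by (simp add: tensor_apply_scaleR)
  qed
  then show ?thesis
    by (simp add: homogenized_poly_def tuple_poly_def scaleR_right_distrib scaleR_sum_right)
qed

text \<open>Since \<open>0 ^ 0 = 1\<close>, the summand for \<open>k = 1\<close> survives at
  \<open>t = 0\<close>. The bound on \<open>m\<close> puts this index in range and makes the
  coefficient of \<open>a\<close> vanish.\<close>

lemma homogenized_poly_0:
  assumes "m \<ge> 2"
  shows "homogenized_poly m \<Lambda> a 0 y = tensor_apply m (\<Lambda> 1) y"
proof -
  have "(\<Sum>k = 1..m - 1. 0 ^ (k - 1) *\<^sub>R tensor_apply (m - k + 1) (\<Lambda> k) y) =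
      (\<Sum>k\<in>{1}. 0 ^ (k - 1) *\<^sub>R tensor_apply (m - k + 1) (\<Lambda> k) y)"
    using assms by (intro sum.mono_neutral_right) auto
  then show ?thesis using assms by (simp add: homogenized_poly_def)
qed

section \<open>Joint continuity in the coefficients and the point\<close>

lemma tendsto_prod_list:
  fixes f :: "'b \<Rightarrow> 'a \<Rightarrow> 'c::real_normed_field"
  assumes "\<And>i. i \<in> set is \<Longrightarrow> ((\<lambda>x. f x i) \<longlongrightarrow> g i) F"
  shows "((\<lambda>x. \<Prod>i\<leftarrow>is. f x i) \<longlongrightarrow> (\<Prod>i\<leftarrow>is. g i)) F"
  using assms by (induction "is") (auto intro!: tendsto_mult)

text \<open>The length \<open>Suc (p - 1)\<close> is that of the lists \<open>j # js\<close> at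
  which the tensor is read; it differs from \<open>p\<close> only for \<open>p = 0\<close>.\<close>

lemma tendsto_tensor_apply:
  assumes "\<And>js. js \<in> multi_indices (Suc (p - 1)) \<Longrightarrow> ((\<lambda>i. A i js) \<longlongrightarrow> B js) F"
    and "(x \<longlongrightarrow> y) F"
  shows "((\<lambda>i. tensor_apply p (A i) (x i)) \<longlongrightarrow> tensor_apply p B y) F"
  unfolding tensor_apply_def
  by (intro tendsto_vec_lambda tendsto_sum tendsto_mult tendsto_prod_list tendsto_vec_nth assms)
    (simp add: multi_indices_def)

text \<open>Two nested Euclidean norms dominate each entry, so convergence in
  \<open>tuple_dist\<close> yields convergence of every coefficient.\<close>

lemma abs_diff_le_tuple_dist:
  assumes "k \<in> {1..m - 1}" and "js \<in> (multi_indices (m - k + 1) :: 'n::finite list set)"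
  shows "\<bar>\<Lambda>\<^sub>1 k js - \<Lambda>\<^sub>2 k js\<bar> \<le> tuple_dist m \<Lambda>\<^sub>1 \<Lambda>\<^sub>2"
proof -
  have "\<bar>\<Lambda>\<^sub>1 k js - \<Lambda>\<^sub>2 k js\<bar> \<le> L2_set (\<lambda>js. \<bar>\<Lambda>\<^sub>1 k js - \<Lambda>\<^sub>2 k js\<bar>) (multi_indices (m - k + 1))"
    using assms(2) by (intro member_le_L2_set) auto
  also have "\<dots> = frobenius_norm (m - k + 1) (\<lambda>js. \<Lambda>\<^sub>1 k js - \<Lambda>\<^sub>2 k js)"
    by (simp add: frobenius_norm_def L2_set_def)
  also have "\<dots> \<le> tuple_dist m \<Lambda>\<^sub>1 \<Lambda>\<^sub>2"
    unfolding tuple_dist_def using assms(1) by (intro member_le_L2_set) auto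
  finally show ?thesis .
qed

lemma tendsto_homogenized_poly:
  fixes L :: "'n::finite tensor_tuple"
  assumes L: "((\<lambda>i. tuple_dist m L (\<Lambda> i)) \<longlongrightarrow> 0) F"
    and "(a \<longlongrightarrow> a\<^sub>0) F" "(t \<longlongrightarrow> t\<^sub>0) F" "(y \<longlongrightarrow> y\<^sub>0) F"
  shows "((\<lambda>i. homogenized_poly m (\<Lambda> i) (a i) (t i) (y i)) \<longlongrightarrow> homogenized_poly m L a\<^sub>0 t\<^sub>0 y\<^sub>0) F"
proof -
  have "((\<lambda>i. \<Lambda> i k js) \<longlongrightarrow> L k js) F"
    if "k \<in> {1..m - 1}" "js \<in> multi_indices (m - k + 1)" for k js
  proof -
    have "((\<lambda>i. \<Lambda> i k js - L k js) \<longlongrightarrow> 0) F"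
      by (rule Lim_null_comparison[OF _ L])
        (use abs_diff_le_tuple_dist[OF that] in \<open>simp add: abs_minus_commute\<close>)
    then show ?thesis by (simp add: LIM_zero_iff)
  qed
  then show ?thesis
    unfolding homogenized_poly_def
    by (intro tendsto_intros tendsto_tensor_apply assms) auto
qed

section \<open>Limits of cones and dual cones\<close>

lemma closed_convex_cones_mult:
  assumes "K \<in> closed_convex_cones" "x \<in> K" "0 \<le> c"
  shows "c *\<^sub>R x \<in> K"
  using assms by (simp add: closed_convex_cones_def convex_cone_scaleR)

lemma closed_convex_cones_mult_iff:
  assumes "K \<in> closed_convex_cones" "0 < c"
  shows "c *\<^sub>R x \<in> K \<longleftrightarrow> x \<in> K"
  using closed_convex_cones_mult[OF assms(1), of x c]
    closed_convex_cones_mult[OF assms(1), of "c *\<^sub>R x" "inverse c"] assms(2) by auto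

lemma dual_cone_mult_iff: "0 < c \<Longrightarrow> c *\<^sub>R x \<in> dual_cone K \<longleftrightarrow> x \<in> dual_cone K"
  by (simp add: dual_cone_def zero_le_mult_iff)

text \<open>\<open>cone_dist\<close> compares distances on the unit ball only, so the bounded
  sequence \<open>f\<close> is first shrunk by a common factor \<open>inverse R\<close>. The shrunk
  points stay in \<open>K i\<close>, hence their distance to \<open>L\<close> is at most
  \<open>cone_dist L (K i)\<close>; closedness of \<open>L\<close> finishes.\<close>

lemma limit_in_closed_convex_cone:
  fixes K :: "nat \<Rightarrow> (real ^ 'n::finite) set"
  assumes K: "\<And>i. K i \<in> closed_convex_cones" and L: "L \<in> closed_convex_cones"
    and lim: "(\<lambda>i. cone_dist L (K i)) \<longlonglongrightarrow> 0"
    and f: "\<And>i. f i \<in> K i" "f \<longlonglongrightarrow> g"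
  shows "g \<in> L"
proof -
  obtain R where R: "R > 0" "\<And>i. norm (f i) \<le> R"
    using convergent_imp_Bseq[OF convergentI[OF f(2)]] by (auto elim: BseqE)
  have bound: "infdist (inverse R *\<^sub>R f i) L \<le> cone_dist L (K i)" for i
  proof -
    have "inverse R *\<^sub>R f i \<in> K i"
      using closed_convex_cones_mult[OF K f(1)] R(1) by simp
    moreover have "norm (inverse R *\<^sub>R f i) \<le> 1"
      using R by (simp add: divide_simps)
    ultimately show ?thesis
      using infdist_diff_le_cone_dist[of "inverse R *\<^sub>R f i" L "K i"] by simp
  qed
  have "(\<lambda>i. infdist (inverse R *\<^sub>R f i) L) \<longlonglongrightarrow> infdist (inverse R *\<^sub>R g) L"
    by (intro tendsto_infdist tendsto_intros f)
  then have "infdist (inverse R *\<^sub>R g) L \<le> 0"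
    using lim bound by (blast intro: LIMSEQ_le)
  then have "infdist (inverse R *\<^sub>R g) L = 0"
    using infdist_nonneg[of "inverse R *\<^sub>R g" L] by linarith
  then have "inverse R *\<^sub>R g \<in> L"
    using L by (simp add: in_closed_iff_infdist_zero closed_convex_cones_def convex_cone_nonempty)
  then show ?thesis
    using closed_convex_cones_mult_iff[OF L] R(1) by simp
qed

text \<open>Every \<open>x\<close> in \<open>L\<close> of norm at most 1 is the limit of its nearest
  points in the cones \<open>K i\<close>, and the inequalities against those points pass to the
  limit. Scaling removes the norm bound.\<close>

lemma limit_in_dual_cone:
  fixes K :: "nat \<Rightarrow> (real ^ 'n::finite) set"
  assumes K: "\<And>i. K i \<in> closed_convex_cones" and L: "L \<in> closed_convex_cones"
    and lim: "(\<lambda>i. cone_dist L (K i)) \<longlonglongrightarrow> 0"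
    and g: "\<And>i. g i \<in> dual_cone (K i)" "g \<longlonglongrightarrow> h"
  shows "h \<in> dual_cone L"
proof -
  have unit: "0 \<le> h \<bullet> x" if x: "x \<in> L" "norm x \<le> 1" for x
  proof -
    have "\<exists>u\<in>K i. infdist x (K i) = dist x u" for i
      using K[of i] infdist_attains_inf[of "K i" x]
      by (auto simp: closed_convex_cones_def convex_cone_nonempty)
    then obtain u where u: "\<And>i. u i \<in> K i" "\<And>i. infdist x (K i) = dist x (u i)"
      by metis
    \<comment> \<open>As \<open>x\<close> lies in \<open>L\<close>, its distance to \<open>L\<close>
      is 0, so \<open>cone_dist\<close> bounds its distance to \<open>K i\<close>, which
      \<open>u i\<close> attains.\<close>
    have "norm (u i - x) \<le> cone_dist L (K i)" for i
      using infdist_diff_le_cone_dist[OF x(2), of L "K i"] x(1) u(2)[of i]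
      by (simp add: dist_norm norm_minus_commute)
    then have "(\<lambda>i. u i - x) \<longlonglongrightarrow> 0"
      by (intro Lim_null_comparison[OF _ lim]) simp
    then have "u \<longlonglongrightarrow> x" by (simp add: LIM_zero_iff)
    then have "(\<lambda>i. g i \<bullet> u i) \<longlonglongrightarrow> h \<bullet> x"
      by (intro tendsto_inner g)
    moreover have "0 \<le> g i \<bullet> u i" for i
      using g(1)[of i] u(1)[of i] by (simp add: dual_cone_def)
    ultimately show ?thesis by (intro LIMSEQ_le_const) auto
  qed
  have "0 \<le> h \<bullet> x" if "x \<in> L" for x
  proof (cases "x = 0")
    case False
    have "0 \<le> h \<bullet> (inverse (norm x) *\<^sub>R x)"
      using False closed_convex_cones_mult[OF L that, of "inverse (norm x)"] by (intro unit) auto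
    then show ?thesis using False by (simp add: zero_le_mult_iff)
  qed simp
  then show ?thesis by (simp add: dual_cone_def)
qed

section \<open>Upper semicontinuity\<close>

text \<open>Homogenising multiplies the two maps by the positive factors \<open>t ^ (m - 1)\<close>
  and \<open>t ^ (l - 1)\<close>. These may differ, but membership in a cone and orthogonality
  ignore them; \<open>solution_if_scaled\<close> reverses the passage.\<close>

lemma scaled_solution:
  assumes "x \<in> SOL m l (\<Lambda>, a, \<Theta>, b, K)" "K \<in> closed_convex_cones" "0 < t"
  shows "homogenized_poly m \<Lambda> a t (t *\<^sub>R x) \<in> K"
    and "homogenized_poly l \<Theta> b t (t *\<^sub>R x) \<in> dual_cone K"
    and "homogenized_poly m \<Lambda> a t (t *\<^sub>R x) \<bullet> homogenized_poly l \<Theta> b t (t *\<^sub>R x) = 0"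
  using assms unfolding homogenized_poly_scaleR SOL_def
  by (auto simp: closed_convex_cones_mult_iff dual_cone_mult_iff)

lemma solution_if_scaled:
  assumes "homogenized_poly m \<Lambda> a t y \<in> K"
    and "homogenized_poly l \<Theta> b t y \<in> dual_cone K"
    and "homogenized_poly m \<Lambda> a t y \<bullet> homogenized_poly l \<Theta> b t y = 0"
    and "K \<in> closed_convex_cones" "0 < t"
  shows "inverse t *\<^sub>R y \<in> SOL m l (\<Lambda>, a, \<Theta>, b, K)"
proof -
  have "y = t *\<^sub>R (inverse t *\<^sub>R y)" using assms(5) by simp
  then have "homogenized_poly m \<Lambda> a t y = t ^ (m - 1) *\<^sub>R tuple_poly m \<Lambda> a (inverse t *\<^sub>R y)"
    and "homogenized_poly l \<Theta> b t y = t ^ (l - 1) *\<^sub>R tuple_poly l \<Theta> b (inverse t *\<^sub>R y)"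
    by (metis homogenized_poly_scaleR)+
  with assms show ?thesis
    by (simp add: SOL_def closed_convex_cones_mult_iff dual_cone_mult_iff)
qed

text \<open>Local boundedness of the solutions and closedness of the graph of \<open>SOL\<close> are
  obtained together, in sequential form.\<close>

lemma solutions_cluster:
  fixes L T :: "'n::finite tensor_tuple" and K :: "nat \<Rightarrow> (real ^ 'n) set"
  assumes ml: "m \<ge> 2" "l \<ge> 2"
    and R0: "R0_tensor_pair m l K\<^sub>0 (L 1) (T 1)"
    and cones: "\<And>i. K i \<in> closed_convex_cones" "K\<^sub>0 \<in> closed_convex_cones"
    and lim: "(\<lambda>i. tuple_dist m L (\<Lambda> i)) \<longlonglongrightarrow> 0" "a \<longlonglongrightarrow> a\<^sub>0"
      "(\<lambda>i. tuple_dist l T (\<Theta> i)) \<longlonglongrightarrow> 0" "b \<longlonglongrightarrow> b\<^sub>0"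
      "(\<lambda>i. cone_dist K\<^sub>0 (K i)) \<longlonglongrightarrow> 0"
    and x: "\<And>i. x i \<in> SOL m l (\<Lambda> i, a i, \<Theta> i, b i, K i)"
  obtains r z where "strict_mono r" "(x \<circ> r) \<longlonglongrightarrow> z" "z \<in> SOL m l (L, a\<^sub>0, T, b\<^sub>0, K\<^sub>0)"
proof -
  \<comment> \<open>The maximum with 1 keeps \<open>t i\<close> in \<open>(0, 1]\<close> even when
    \<open>x i\<close> is 0, so bounded and unbounded sequences are treated alike.\<close>
  define t where "t i = inverse (max 1 (norm (x i)))" for i
  define y where "y i = t i *\<^sub>R x i" for i
  have t: "0 < t i" "t i \<le> 1" for i
    by (auto simp: t_def inverse_le_1_iff)
  have norm_y: "norm (y i) \<le> 1" for i
    by (auto simp: y_def t_def divide_simps)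
  \<comment> \<open>When \<open>t i < 1\<close>, the maximum is \<open>norm (x i)\<close>, so
    \<open>y i\<close> is exactly normalised.\<close>
  have norm_y_eq: "norm (y i) = 1" if "t i < 1" for i
  proof -
    have "norm (x i) > 1"
      using that by (auto simp: t_def inverse_less_1_iff)
    then show ?thesis by (auto simp: y_def t_def intro!: left_inverse)
  qed
  have "compact ({0..1} \<times> cball 0 1 :: (real \<times> (real ^ 'n)) set)"
    by (intro compact_Times) auto
  then have "seq_compact ({0..1} \<times> cball 0 1 :: (real \<times> (real ^ 'n)) set)"
    by (rule compact_imp_seq_compact)
  moreover have "\<forall>i. (t i, y i) \<in> {0..1} \<times> cball 0 1"
    using t norm_y by (simp add: less_imp_le)
  ultimately obtain p r where "p \<in> {0..1} \<times> cball 0 1" and r: "strict_mono r"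
    and "((\<lambda>i. (t i, y i)) \<circ> r) \<longlonglongrightarrow> p"
    by (rule seq_compactE[where f = "\<lambda>i. (t i, y i)"])
  moreover obtain t\<^sub>0 y\<^sub>0 where "p = (t\<^sub>0, y\<^sub>0)"
    by fastforce
  ultimately have ty: "(t\<^sub>0, y\<^sub>0) \<in> {0..1} \<times> cball 0 1"
    and lim_ty: "((\<lambda>i. (t i, y i)) \<circ> r) \<longlonglongrightarrow> (t\<^sub>0, y\<^sub>0)"
    by simp_all
  from tendsto_fst[OF lim_ty] tendsto_snd[OF lim_ty]
  have t_lim: "(\<lambda>i. t (r i)) \<longlonglongrightarrow> t\<^sub>0" and y_lim: "(\<lambda>i. y (r i)) \<longlonglongrightarrow> y\<^sub>0"
    by (simp_all add: o_def)
  note sub = LIMSEQ_subseq_LIMSEQ[OF _ r, unfolded o_def]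
  define F where "F = (\<lambda>i. homogenized_poly m (\<Lambda> (r i)) (a (r i)) (t (r i)) (y (r i)))"
  define G where "G = (\<lambda>i. homogenized_poly l (\<Theta> (r i)) (b (r i)) (t (r i)) (y (r i)))"
  let ?F = "homogenized_poly m L a\<^sub>0 t\<^sub>0 y\<^sub>0" and ?G = "homogenized_poly l T b\<^sub>0 t\<^sub>0 y\<^sub>0"
  have F_lim: "F \<longlonglongrightarrow> ?F"
    unfolding F_def by (rule tendsto_homogenized_poly[OF sub[OF lim(1)] sub[OF lim(2)] t_lim y_lim])
  have G_lim: "G \<longlonglongrightarrow> ?G"
    unfolding G_def by (rule tendsto_homogenized_poly[OF sub[OF lim(3)] sub[OF lim(4)] t_lim y_lim])
  have FG: "F i \<in> K (r i)" "G i \<in> dual_cone (K (r i))" "F i \<bullet> G i = 0" for i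
    using scaled_solution[OF x cones(1) t(1), of "r i" "r i"] by (simp_all add: F_def G_def y_def)
  have "?F \<in> K\<^sub>0"
    by (rule limit_in_closed_convex_cone[OF cones sub[OF lim(5)] FG(1) F_lim])
  moreover have "?G \<in> dual_cone K\<^sub>0"
    by (rule limit_in_dual_cone[OF cones sub[OF lim(5)] FG(2) G_lim])
  moreover have "?F \<bullet> ?G = 0"
    using tendsto_inner[OF F_lim G_lim] by (simp add: FG(3) LIMSEQ_const_iff)
  ultimately have limit: "?F \<in> K\<^sub>0" "?G \<in> dual_cone K\<^sub>0" "?F \<bullet> ?G = 0" .
  \<comment> \<open>A zero limit would mean that the solutions escape to infinity along
    \<open>r\<close>; their directions then converge to a unit vector satisfying the leading-term
    conditions.\<close>
  have "t\<^sub>0 \<noteq> 0"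
  proof
    assume "t\<^sub>0 = 0"
    then have "\<forall>\<^sub>F i in sequentially. t (r i) < 1"
      using order_tendstoD(2)[OF t_lim, of 1] by simp
    then have "\<forall>\<^sub>F i in sequentially. norm (y (r i)) = 1"
      by (rule eventually_mono) (rule norm_y_eq)
    then have "(\<lambda>i. norm (y (r i))) \<longlonglongrightarrow> 1"
      by (rule tendsto_eventually)
    then have "norm y\<^sub>0 = 1"
      using LIMSEQ_unique tendsto_norm[OF y_lim] by blast
    then have "y\<^sub>0 \<noteq> 0" by auto
    with limit R0 show False
      unfolding \<open>t\<^sub>0 = 0\<close> homogenized_poly_0[OF ml(1)] homogenized_poly_0[OF ml(2)] R0_tensor_pair_def
      by blast
  qed
  then have "0 < t\<^sub>0" using ty by auto
  have x_eq: "x = (\<lambda>i. inverse (t i) *\<^sub>R y i)"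
    using t(1) by (simp add: y_def order_less_imp_not_eq2)
  have "(x \<circ> r) \<longlonglongrightarrow> inverse t\<^sub>0 *\<^sub>R y\<^sub>0"
    unfolding x_eq o_def by (intro tendsto_intros t_lim y_lim \<open>t\<^sub>0 \<noteq> 0\<close>)
  moreover have "inverse t\<^sub>0 *\<^sub>R y\<^sub>0 \<in> SOL m l (L, a\<^sub>0, T, b\<^sub>0, K\<^sub>0)"
    using limit cones(2) \<open>0 < t\<^sub>0\<close> by (rule solution_if_scaled)
  ultimately show thesis using r that by blast
qed

text \<open>A product of metric balls with a common radius serves as \<open>V\<close>; membership of
  \<open>K'\<close> in the carrier comes from its ball.\<close>

lemma problem_topology_neighbourhood:
  fixes \<Lambda> \<Theta> :: "'n::finite tensor_tuple" and K :: "(real ^ 'n) set"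
  assumes "\<Lambda> \<in> tensor_tuples m" "\<Theta> \<in> tensor_tuples l" "K \<in> closed_convex_cones" "0 < e"
  obtains V where "openin (problem_topology m l) V" "(\<Lambda>, a, \<Theta>, b, K) \<in> V"
    "\<And>\<Lambda>' a' \<Theta>' b' K'. (\<Lambda>', a', \<Theta>', b', K') \<in> V \<Longrightarrow>
       K' \<in> closed_convex_cones \<and> tuple_dist m \<Lambda> \<Lambda>' < e \<and> dist a a' < e \<and>
       tuple_dist l \<Theta> \<Theta>' < e \<and> dist b b' < e \<and> cone_dist K K' < e"
proof -
  interpret M: Metric_space "tensor_tuples m :: 'n tensor_tuple set" "tuple_dist m"
    by (rule Metric_space_tensor_tuples)
  interpret T: Metric_space "tensor_tuples l :: 'n tensor_tuple set" "tuple_dist l"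
    by (rule Metric_space_tensor_tuples)
  interpret C: Metric_space "closed_convex_cones :: (real ^ 'n) set set" cone_dist
    by (rule Metric_space_closed_convex_cones)
  let ?V = "M.mball \<Lambda> e \<times> ball a e \<times> T.mball \<Theta> e \<times> ball b e \<times> C.mball K e"
  have "openin (problem_topology m l) ?V"
    by (simp add: problem_topology_def openin_prod_Times_iff)
  then show thesis using assms by (intro that[of ?V]) auto
qed

theorem proposition4p5:
  fixes m l :: nat
    and \<Lambda> \<Theta> :: "'n::finite tensor_tuple"
    and a b :: "real ^ 'n"
    and K :: "(real ^ 'n) set"
  assumes "CARD('n) \<ge> 2" and "m \<ge> 2" and "l \<ge> 2"
    and "\<Lambda> \<in> tensor_tuples m" and "\<Theta> \<in> tensor_tuples l"
    and "K \<in> closed_convex_cones"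
    and "R0_tensor_pair m l K (\<Lambda> 1) (\<Theta> 1)"
  shows "upper_semicontinuous_at (problem_topology m l) euclidean (SOL m l) (\<Lambda>, a, \<Theta>, b, K)"
proof (rule ccontr)
  assume "\<not> ?thesis"
  then obtain U where U: "open U" "SOL m l (\<Lambda>, a, \<Theta>, b, K) \<subseteq> U"
    and V: "\<And>V. openin (problem_topology m l) V \<Longrightarrow> (\<Lambda>, a, \<Theta>, b, K) \<in> V \<Longrightarrow>
      \<exists>w\<in>V. \<not> SOL m l w \<subseteq> U"
    unfolding upper_semicontinuous_at_def by auto
  \<comment> \<open>Shrinking radii turn the failure on every neighbourhood into a sequence of
    problems converging to the given one, each with a solution outside \<open>U\<close>.\<close>
  define e where "e i = inverse (real (Suc i))" for i
  have e_lim: "e \<longlonglongrightarrow> 0"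
    unfolding e_def by (rule LIMSEQ_inverse_real_of_nat)
  have "\<exists>\<Lambda>' a' \<Theta>' b' K' x. K' \<in> closed_convex_cones \<and> tuple_dist m \<Lambda> \<Lambda>' < e i \<and>
      dist a a' < e i \<and> tuple_dist l \<Theta> \<Theta>' < e i \<and> dist b b' < e i \<and> cone_dist K K' < e i \<and>
      x \<in> SOL m l (\<Lambda>', a', \<Theta>', b', K') \<and> x \<notin> U" for i
  proof -
    have "0 < e i" by (simp add: e_def)
    from problem_topology_neighbourhood[OF assms(4-6) this, of a b]
    obtain W where W: "openin (problem_topology m l) W" "(\<Lambda>, a, \<Theta>, b, K) \<in> W"
      "\<And>\<Lambda>' a' \<Theta>' b' K'. (\<Lambda>', a', \<Theta>', b', K') \<in> W \<Longrightarrow>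
         K' \<in> closed_convex_cones \<and> tuple_dist m \<Lambda> \<Lambda>' < e i \<and> dist a a' < e i \<and>
         tuple_dist l \<Theta> \<Theta>' < e i \<and> dist b b' < e i \<and> cone_dist K K' < e i"
      by blast
    obtain \<Lambda>' a' \<Theta>' b' K' where w: "(\<Lambda>', a', \<Theta>', b', K') \<in> W"
      and "\<not> SOL m l (\<Lambda>', a', \<Theta>', b', K') \<subseteq> U"
      using V[OF W(1,2)] by (metis prod_cases5)
    then obtain x where "x \<in> SOL m l (\<Lambda>', a', \<Theta>', b', K')" "x \<notin> U" by blast
    with W(3)[OF w] show ?thesis by blast
  qed
  then obtain \<Lambda>' a' \<Theta>' b' K' x where seq: "\<And>i. K' i \<in> closed_convex_cones"
    "\<And>i. tuple_dist m \<Lambda> (\<Lambda>' i) < e i" "\<And>i. dist a (a' i) < e i"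
    "\<And>i. tuple_dist l \<Theta> (\<Theta>' i) < e i" "\<And>i. dist b (b' i) < e i"
    "\<And>i. cone_dist K (K' i) < e i"
    "\<And>i. x i \<in> SOL m l (\<Lambda>' i, a' i, \<Theta>' i, b' i, K' i)" "\<And>i. x i \<notin> U"
    by metis
  have null: "f \<longlonglongrightarrow> 0" if "\<And>i. 0 \<le> f i" "\<And>i. f i < e i" for f :: "nat \<Rightarrow> real"
    using that by (intro Lim_null_comparison[OF _ e_lim]) (simp add: less_imp_le)
  have tensors: "(\<lambda>i. tuple_dist m \<Lambda> (\<Lambda>' i)) \<longlonglongrightarrow> 0" "(\<lambda>i. tuple_dist l \<Theta> (\<Theta>' i)) \<longlonglongrightarrow> 0"
    and cone: "(\<lambda>i. cone_dist K (K' i)) \<longlonglongrightarrow> 0"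
    using seq Metric_space.nonneg[OF Metric_space_tensor_tuples]
      Metric_space.nonneg[OF Metric_space_closed_convex_cones] by (intro null; blast)+
  have vectors: "a' \<longlonglongrightarrow> a" "b' \<longlonglongrightarrow> b"
    using null[of "\<lambda>i. dist a (a' i)"] null[of "\<lambda>i. dist b (b' i)"] seq(3,5)
    by (simp_all add: tendsto_dist_iff[of a'] tendsto_dist_iff[of b'] dist_commute)
  obtain r z where z: "(x \<circ> r) \<longlonglongrightarrow> z" "z \<in> SOL m l (\<Lambda>, a, \<Theta>, b, K)"
    by (rule solutions_cluster[OF assms(2,3,7) seq(1) assms(6)
          tensors(1) vectors(1) tensors(2) vectors(2) cone seq(7)])
  \<comment> \<open>The complement of the open set \<open>U\<close> is closed, so it keeps the limit
    of the solutions chosen outside \<open>U\<close>.\<close>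
  have "z \<notin> U"
    using closed_sequentially[of "- U" "x \<circ> r" z] U(1) z(1) seq(8) by (simp add: closed_Compl)
  with z(2) U(2) show False by blast
qed

end
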